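(* For positive integers $p,m$, the quadratic sums \[S(1,p+1;p+2m)=\sum_{n=1}^\infty\frac{H_n\zeta_n(p+1)}{n^{p+2m}},\qquad S(1,p+2m;p+1)=\sum_{n=1}^\infty\frac{H_n\zeta_n(p+2m)}{n^{p+1}}\] are reducible to linear sums, i.e. each can be written as a polynomial with rational coefficients in the values $\zeta(k)$ ($k\ge2$) and the linear sums $S(a;b)$ ($a\ge1$, $b\ge2$).
   Context: For positive integers $k,n$, $\zeta_n(k)=\sum_{j=1}^n j^{-k}$, $H_n=\zeta_n(1)$, and $\zeta(s)=\sum_{n\ge1}n^{-s}$. For positive integers $a,q$ with $q\ge2$, the linear sum is $S(a;q)=\sum_{n\ge1}\zeta_n(a)n^{-q}$. *)

theory Defs
  imports "HOL-Analysis.Analysis" "HOL-Library.Poly_Mapping"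
begin

definition zeta_part :: "nat \<Rightarrow> nat \<Rightarrow> real" where
  "zeta_part n k = (\<Sum>j = 1..n. 1 / real j ^ k)"

lemma zeta_part_1_eq_harm: "zeta_part n 1 = harm n"
  by (simp add: zeta_part_def harm_def divide_inverse)

text \<open>
  The series are indexed from \<open>0\<close>, so the summation index is \<open>Suc n\<close>. They use \<^const>\<open>suminf\<close>
  explicitly because the theory of poly mappings overloads the binder notation with \<^const>\<open>Sum_any\<close>.
\<close>

definition zeta_value :: "nat \<Rightarrow> real" where
  "zeta_value k = suminf (\<lambda>n. 1 / real (Suc n) ^ k)"

definition linear_sum :: "nat \<Rightarrow> nat \<Rightarrow> real" where
  "linear_sum a q = suminf (\<lambda>n. zeta_part (Suc n) a / real (Suc n) ^ q)"

definition quadratic_sum :: "nat \<Rightarrow> nat \<Rightarrow> nat \<Rightarrow> real" where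
  "quadratic_sum a b q =
     suminf (\<lambda>n. zeta_part (Suc n) a * zeta_part (Suc n) b / real (Suc n) ^ q)"

text \<open>
  A polynomial over \<open>\<rat>\<close> is a finitely supported map from monomials to coefficients, a monomial
  being a finitely supported map from indeterminates to exponents. The indeterminates are
  labelled by the real numbers that are substituted for them.
\<close>

definition eval_rat_poly :: "((real \<Rightarrow>\<^sub>0 nat) \<Rightarrow>\<^sub>0 rat) \<Rightarrow> real" where
  "eval_rat_poly P =
     (\<Sum>t \<in> Poly_Mapping.keys P. of_rat (Poly_Mapping.lookup P t) *
        (\<Prod>v \<in> Poly_Mapping.keys t. v ^ Poly_Mapping.lookup t v))"

definition rat_polynomial_in :: "real set \<Rightarrow> real \<Rightarrow> bool" where
  "rat_polynomial_in A x \<longleftrightarrow>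
     (\<exists>P :: (real \<Rightarrow>\<^sub>0 nat) \<Rightarrow>\<^sub>0 rat.
        (\<forall>t \<in> Poly_Mapping.keys P. Poly_Mapping.keys t \<subseteq> A) \<and> x = eval_rat_poly P)"

definition reducible_to_linear_sums :: "real \<Rightarrow> bool" where
  "reducible_to_linear_sums x \<longleftrightarrow>
     rat_polynomial_in
       ({zeta_value k | k. k \<ge> 2} \<union> {linear_sum a b | a b. a \<ge> 1 \<and> b \<ge> 2}) x"

end

theory Submission imports Defs begin

text \<open>
  Extend the harmonic numbers to all integers by \<open>h n = H\<^bsub>n - 1\<^esub>\<close> for \<open>n > 0\<close> and \<open>h n = H\<^bsub>- n\<^esub>\<close> for
  \<open>n \<le> 0\<close>, so that \<open>h n - h (n - 1) = 1 / (n - 1)\<close>, and consider the sum \<open>S\<close> of \<open>h n / (n\<^sup>a m\<^sup>b)\<close> over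
  all nonzero integers \<open>n < m\<close>, where \<open>a, b \<ge> 2\<close>. Splitting it by the signs of \<open>n\<close> and \<open>m\<close> gives
  \<open>((-1)\<^bsup>a + b\<^esup> - 1) S(1, b; a)\<close> up to products of zeta values and linear sums, and the factor is \<open>-2\<close>
  for odd \<open>a + b\<close>. On the other hand, writing \<open>m = n + d\<close> and decomposing into partial fractions in
  \<open>n\<close>, the sum over \<open>n\<close> for fixed \<open>d\<close> reduces to the sums of \<open>h (m - d) / m\<^sup>k\<close> over \<open>m\<close>. Their
  differences in \<open>d\<close> are sums of rational functions over the integers, hence polynomials in \<open>1 / d\<close>,
  so they are combinations of the \<open>\<zeta>\<^sub>d(j)\<close> and summing over \<open>d\<close> yields linear sums only.
\<close>

subsection \<open>The ring of reducible numbers\<close>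

definition monomial_value :: "(real \<Rightarrow>\<^sub>0 nat) \<Rightarrow> real" where
  "monomial_value t = (\<Prod>v \<in> Poly_Mapping.keys t. v ^ Poly_Mapping.lookup t v)"

text \<open>Indeterminates outside the support have exponent 0 and contribute a factor 1. This lets
  two monomials be evaluated over one common finite set; \<open>eval_rat_poly_superset\<close> does
  the same for coefficients 0.\<close>

lemma monomial_value_superset:
  assumes "finite V" "Poly_Mapping.keys t \<subseteq> V"
  shows "monomial_value t = (\<Prod>v \<in> V. v ^ Poly_Mapping.lookup t v)"
  unfolding monomial_value_def using assms
  by (intro prod.mono_neutral_left) (auto simp: in_keys_iff)

lemma monomial_value_add: "monomial_value (s + t) = monomial_value s * monomial_value t"
proof -
  let ?V = "Poly_Mapping.keys s \<union> Poly_Mapping.keys t"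
  have "Poly_Mapping.keys (s + t) \<subseteq> ?V" by (rule Poly_Mapping.keys_add)
  then show ?thesis
    by (simp add: monomial_value_superset[of ?V] lookup_add power_add prod.distrib)
qed

lemma eval_rat_poly_superset:
  assumes "finite S" "Poly_Mapping.keys P \<subseteq> S"
  shows "eval_rat_poly P = (\<Sum>t \<in> S. of_rat (Poly_Mapping.lookup P t) * monomial_value t)"
  unfolding eval_rat_poly_def monomial_value_def[symmetric] using assms
  by (intro sum.mono_neutral_left) (auto simp: in_keys_iff)

lemma eval_rat_poly_add: "eval_rat_poly (P + Q) = eval_rat_poly P + eval_rat_poly Q"
proof -
  let ?S = "Poly_Mapping.keys P \<union> Poly_Mapping.keys Q"
  have "Poly_Mapping.keys (P + Q) \<subseteq> ?S" by (rule Poly_Mapping.keys_add)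
  then show ?thesis
    by (simp add: eval_rat_poly_superset[of ?S] lookup_add of_rat_add distrib_right sum.distrib)
qed

lemma rat_polynomial_in_add:
  assumes "rat_polynomial_in A x" "rat_polynomial_in A y"
  shows "rat_polynomial_in A (x + y)"
proof -
  obtain P Q where "\<forall>t \<in> Poly_Mapping.keys P. Poly_Mapping.keys t \<subseteq> A" "x = eval_rat_poly P"
    "\<forall>t \<in> Poly_Mapping.keys Q. Poly_Mapping.keys t \<subseteq> A" "y = eval_rat_poly Q"
    using assms unfolding rat_polynomial_in_def by blast
  then have "\<forall>t \<in> Poly_Mapping.keys (P + Q). Poly_Mapping.keys t \<subseteq> A" "x + y = eval_rat_poly (P + Q)"
    using Poly_Mapping.keys_add[of P Q] by (auto simp: eval_rat_poly_add)
  then show ?thesis unfolding rat_polynomial_in_def by blast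
qed

lemma rat_polynomial_in_monomial:
  assumes "Poly_Mapping.keys t \<subseteq> A"
  shows "rat_polynomial_in A (of_rat c * monomial_value t)"
proof -
  have "eval_rat_poly (Poly_Mapping.single t c) = of_rat c * monomial_value t"
    by (subst eval_rat_poly_superset[of "{t}"]) auto
  moreover have "\<forall>s \<in> Poly_Mapping.keys (Poly_Mapping.single t c). Poly_Mapping.keys s \<subseteq> A"
    using assms by (cases "c = 0") auto
  ultimately show ?thesis unfolding rat_polynomial_in_def by metis
qed

lemma rat_polynomial_in_of_rat: "rat_polynomial_in A (of_rat c)"
  using rat_polynomial_in_monomial[of 0 A c] by (simp add: monomial_value_def)

lemma rat_polynomial_in_generator: "x \<in> A \<Longrightarrow> rat_polynomial_in A x"
  using rat_polynomial_in_monomial[of "Poly_Mapping.single x 1" A 1]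
  by (simp add: monomial_value_def)

lemma rat_polynomial_in_sum:
  assumes "\<And>i. i \<in> I \<Longrightarrow> rat_polynomial_in A (f i)"
  shows "rat_polynomial_in A (\<Sum>i \<in> I. f i)"
  using assms
  by (induction I rule: infinite_finite_induct)
    (use rat_polynomial_in_of_rat[of A 0] in \<open>auto intro: rat_polynomial_in_add\<close>)

text \<open>Instead of multiplying the polynomials themselves, the product of their values is
  expanded into a double sum of monomial values, so additivity and the single-monomial case
  suffice.\<close>

lemma rat_polynomial_in_mult:
  assumes "rat_polynomial_in A x" "rat_polynomial_in A y"
  shows "rat_polynomial_in A (x * y)"
proof -
  obtain P Q where P: "\<forall>t \<in> Poly_Mapping.keys P. Poly_Mapping.keys t \<subseteq> A" "x = eval_rat_poly P"
    and Q: "\<forall>t \<in> Poly_Mapping.keys Q. Poly_Mapping.keys t \<subseteq> A" "y = eval_rat_poly Q"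
    using assms unfolding rat_polynomial_in_def by blast
  have "x * y = (\<Sum>s \<in> Poly_Mapping.keys P. \<Sum>t \<in> Poly_Mapping.keys Q.
      of_rat (Poly_Mapping.lookup P s * Poly_Mapping.lookup Q t) * monomial_value (s + t))"
    unfolding P(2) Q(2) eval_rat_poly_def monomial_value_def[symmetric]
    by (simp add: sum_product of_rat_mult monomial_value_add mult_ac)
  moreover have "Poly_Mapping.keys (s + t) \<subseteq> A"
    if "s \<in> Poly_Mapping.keys P" "t \<in> Poly_Mapping.keys Q" for s t
    using that P(1) Q(1) Poly_Mapping.keys_add[of s t] by blast
  ultimately show ?thesis
    by (auto intro!: rat_polynomial_in_sum rat_polynomial_in_monomial)
qed

lemma reducible_add:
  "reducible_to_linear_sums x \<Longrightarrow> reducible_to_linear_sums y \<Longrightarrow> reducible_to_linear_sums (x + y)"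
  unfolding reducible_to_linear_sums_def by (rule rat_polynomial_in_add)

lemma reducible_mult:
  "reducible_to_linear_sums x \<Longrightarrow> reducible_to_linear_sums y \<Longrightarrow> reducible_to_linear_sums (x * y)"
  unfolding reducible_to_linear_sums_def by (rule rat_polynomial_in_mult)

lemma reducible_of_int: "reducible_to_linear_sums (of_int k)"
  unfolding reducible_to_linear_sums_def using rat_polynomial_in_of_rat[of _ "of_int k"] by simp

lemma reducible_half: "reducible_to_linear_sums (1 / 2)"
  unfolding reducible_to_linear_sums_def using rat_polynomial_in_of_rat[of _ "1 / 2"]
  by (simp add: of_rat_divide)

lemma reducible_uminus: "reducible_to_linear_sums x \<Longrightarrow> reducible_to_linear_sums (- x)"
  using reducible_mult[OF reducible_of_int[of "-1"]] by simp

lemma reducible_diff: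
  "reducible_to_linear_sums x \<Longrightarrow> reducible_to_linear_sums y \<Longrightarrow> reducible_to_linear_sums (x - y)"
  using reducible_add[OF _ reducible_uminus] by simp

lemma reducible_sign_mult:
  "reducible_to_linear_sums x \<Longrightarrow> reducible_to_linear_sums ((-1) ^ k * x)"
  using reducible_mult[OF reducible_of_int[of "(-1) ^ k"]] by simp

lemma reducible_zeta_value: "k \<ge> 2 \<Longrightarrow> reducible_to_linear_sums (zeta_value k)"
  unfolding reducible_to_linear_sums_def by (rule rat_polynomial_in_generator) blast

lemma reducible_linear_sum:
  "a \<ge> 1 \<Longrightarrow> b \<ge> 2 \<Longrightarrow> reducible_to_linear_sums (linear_sum a b)"
  unfolding reducible_to_linear_sums_def by (rule rat_polynomial_in_generator) blast

subsection \<open>Convergence of Euler sums\<close>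

lemma zeta_part_0 [simp]: "zeta_part 0 k = 0"
  by (simp add: zeta_part_def)

lemma zeta_part_Suc: "zeta_part (Suc n) k = zeta_part n k + 1 / real (Suc n) ^ k"
  by (simp add: zeta_part_def)

lemma zeta_part_nonneg: "zeta_part n k \<ge> 0"
  by (simp add: zeta_part_def sum_nonneg)

lemma zeta_part_antimono:
  assumes "j \<le> k" shows "zeta_part n k \<le> zeta_part n j"
  unfolding zeta_part_def
  by (intro sum_mono divide_left_mono power_increasing) (use assms in auto)

text \<open>The growth is logarithmic, but a square root is enough: it dominates
  \<open>H_n / n^2\<close> by a multiple of \<open>n powr (-3/2)\<close> and makes
  \<open>H_n / n\<close> tend to 0.\<close>

lemma zeta_part_1_le_sqrt: "zeta_part n 1 \<le> 2 * sqrt n"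
proof (induction n)
  case (Suc n)
  define x y where "x = sqrt (real n)" and "y = sqrt (real (Suc n))"
  have xy: "0 \<le> x" "x \<le> y" "1 \<le> y" and sq: "y\<^sup>2 = x\<^sup>2 + 1" and y2: "real (Suc n) = y\<^sup>2"
    by (simp_all add: x_def y_def)
  \<comment> \<open>This uses \<open>1 = (y + x) * (y - x)\<close> and, because
    \<open>1 \<le> y\<close>, the estimate \<open>y + x \<le> 2 * y\<^sup>2\<close>.\<close>
  have "1 \<le> 2 * y\<^sup>2 * (y - x)"
  proof -
    have "1 = (y + x) * (y - x)" using sq by (simp add: algebra_simps power2_eq_square)
    also have "\<dots> \<le> (2 * y\<^sup>2) * (y - x)"
    proof (rule mult_right_mono)
      have "y \<le> y\<^sup>2" using xy by (simp add: power2_eq_square)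
      then show "y + x \<le> 2 * y\<^sup>2" using xy by linarith
    qed (use xy in simp)
    finally show ?thesis by simp
  qed
  then have "1 / real (Suc n) \<le> 2 * (y - x)"
    unfolding y2 using xy by (simp add: divide_simps algebra_simps)
  then have "zeta_part n 1 + 1 / real (Suc n) \<le> 2 * x + 2 * (y - x)"
    using Suc unfolding x_def by (intro add_mono)
  then show ?case
    unfolding zeta_part_Suc power_one_right y_def by simp
qed simp

lemma summable_zeta_part_1_div_square: "summable (\<lambda>n. zeta_part (Suc n) 1 / real (Suc n) ^ 2)"
proof (rule summable_comparison_test)
  show "summable (\<lambda>n. 2 * real (Suc n) powr (-3/2))"
    using summable_real_powr_iff[of "-3/2"] summable_Suc_iff[of "\<lambda>n. real n powr (-3/2)"]
    by (intro summable_mult) auto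
  show "\<exists>N. \<forall>n\<ge>N. norm (zeta_part (Suc n) 1 / real (Suc n) ^ 2) \<le> 2 * real (Suc n) powr (-3/2)"
  proof (intro exI allI impI)
    fix n :: nat
    have "norm (zeta_part (Suc n) 1 / real (Suc n) ^ 2) \<le> 2 * sqrt (Suc n) / real (Suc n) ^ 2"
      using zeta_part_1_le_sqrt[of "Suc n"] zeta_part_nonneg[of "Suc n" 1]
      by (simp add: divide_right_mono)
    also have "\<dots> = 2 * real (Suc n) powr (-3/2)"
      using powr_diff[of "real (Suc n)" "1/2" 2] by (simp add: powr_half_sqrt del: of_nat_Suc)
    finally show "norm (zeta_part (Suc n) 1 / real (Suc n) ^ 2) \<le> 2 * real (Suc n) powr (-3/2)" .
  qed
qed

lemma summable_linear_sum:
  assumes "a \<ge> 1" "q \<ge> 2"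
  shows "summable (\<lambda>n. zeta_part (Suc n) a / real (Suc n) ^ q)"
proof (rule summable_comparison_test[OF _ summable_zeta_part_1_div_square], intro exI allI impI)
  fix n :: nat
  have "zeta_part (Suc n) a / real (Suc n) ^ q \<le> zeta_part (Suc n) 1 / real (Suc n) ^ 2"
    using assms by (intro frac_le zeta_part_nonneg zeta_part_antimono power_increasing) auto
  then show "norm (zeta_part (Suc n) a / real (Suc n) ^ q) \<le> zeta_part (Suc n) 1 / real (Suc n) ^ 2"
    using zeta_part_nonneg[of "Suc n" a] by simp
qed

lemma summable_zeta_value:
  assumes "k \<ge> 2" shows "summable (\<lambda>n. 1 / real (Suc n) ^ k)"
proof (rule summable_comparison_test[OF _ summable_zeta_part_1_div_square], intro exI allI impI)
  fix n :: nat
  have "1 / real (Suc n) ^ k \<le> zeta_part (Suc n) 1 / real (Suc n) ^ 2"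
  proof (intro frac_le power_increasing)
    have "(1::real) = (\<Sum>j = 1..1::nat. 1 / real j ^ 1)" by simp
    also have "\<dots> \<le> zeta_part (Suc n) 1"
      unfolding zeta_part_def by (rule sum_mono2) auto
    finally show "1 \<le> zeta_part (Suc n) 1" .
  qed (use assms zeta_part_nonneg in auto)
  then show "norm (1 / real (Suc n) ^ k) \<le> zeta_part (Suc n) 1 / real (Suc n) ^ 2"
    by simp
qed

lemma zeta_value_sums: "k \<ge> 2 \<Longrightarrow> (\<lambda>n. 1 / real (Suc n) ^ k) sums zeta_value k"
  unfolding zeta_value_def by (rule summable_sums[OF summable_zeta_value])

lemma linear_sum_sums:
  "a \<ge> 1 \<Longrightarrow> q \<ge> 2 \<Longrightarrow> (\<lambda>n. zeta_part (Suc n) a / real (Suc n) ^ q) sums linear_sum a q"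
  unfolding linear_sum_def by (rule summable_sums[OF summable_linear_sum])

lemma zeta_part_le_zeta_value:
  assumes "k \<ge> 2" shows "zeta_part n k \<le> zeta_value k"
proof -
  have "zeta_part n k = (\<Sum>j<n. 1 / real (Suc j) ^ k)"
    by (induction n) (simp_all add: zeta_part_Suc)
  also have "\<dots> \<le> zeta_value k"
    unfolding zeta_value_def by (intro sum_le_suminf summable_zeta_value assms) auto
  finally show ?thesis .
qed

text \<open>For \<open>b \<ge> 2\<close> the factor \<open>zeta_part (Suc n) b\<close> is bounded by
  \<open>zeta_value b\<close>, leaving a multiple of a convergent linear sum.\<close>

lemma quadratic_sum_sums:
  assumes "b \<ge> 2" "q \<ge> 2"
  shows "(\<lambda>n. zeta_part (Suc n) 1 * zeta_part (Suc n) b / real (Suc n) ^ q) sums quadratic_sum 1 b q"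
  unfolding quadratic_sum_def
proof (rule summable_sums, rule summable_comparison_test)
  show "summable (\<lambda>n. zeta_value b * (zeta_part (Suc n) 1 / real (Suc n) ^ q))"
    by (intro summable_mult summable_linear_sum) (use assms in auto)
  have "zeta_part (Suc n) 1 * zeta_part (Suc n) b / real (Suc n) ^ q
      \<le> zeta_part (Suc n) 1 * zeta_value b / real (Suc n) ^ q" for n
    by (intro divide_right_mono mult_left_mono zeta_part_le_zeta_value zeta_part_nonneg assms) auto
  then show "\<exists>N. \<forall>n\<ge>N. norm (zeta_part (Suc n) 1 * zeta_part (Suc n) b / real (Suc n) ^ q)
      \<le> zeta_value b * (zeta_part (Suc n) 1 / real (Suc n) ^ q)"
    by (simp add: zeta_part_nonneg abs_mult mult.commute)
qed

subsection \<open>Sums over the integers\<close>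

lemma summable_on_realI:
  fixes f :: "'a \<Rightarrow> real"
  assumes "g summable_on A" "\<And>x. x \<in> A \<Longrightarrow> \<bar>f x\<bar> \<le> g x"
  shows "f summable_on A"
  using Infinite_Sum.abs_summable_on_comparison_test'[OF assms(1), of f] assms(2)
  by (subst summable_on_iff_abs_summable_on_real) simp

lemma summable_on_times_real:
  fixes f :: "'a \<Rightarrow> real" and g :: "'b \<Rightarrow> real"
  assumes "f summable_on A" "g summable_on B"
  shows "(\<lambda>(x, y). f x * g y) summable_on A \<times> B"
proof (rule summable_on_realI)
  have f: "(\<lambda>x. \<bar>f x\<bar>) summable_on A" and g: "(\<lambda>y. \<bar>g y\<bar>) summable_on B"
    using assms[THEN summable_on_iff_abs_summable_on_real[THEN iffD1]] by simp_all
  show "(\<lambda>(x, y). \<bar>f x\<bar> * \<bar>g y\<bar>) summable_on A \<times> B"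
    by (rule summable_on_SigmaI[where g = "\<lambda>x. \<bar>f x\<bar> * infsum (\<lambda>y. \<bar>g y\<bar>) B"])
      (auto intro!: has_sum_cmult_right has_sum_infsum summable_on_cmult_left f g)
qed (auto simp: abs_mult)

lemma has_sum_single: "((\<lambda>n. if n = k then c else 0) has_sum c) (UNIV :: int set)" for c :: real
  by (rule has_sum_finite_neutralI[of "{k}"]) auto

lemma has_sum_int_split:
  fixes f :: "int \<Rightarrow> real"
  assumes "summable (\<lambda>n. \<bar>f (int (Suc n))\<bar>)" "summable (\<lambda>n. \<bar>f (- int (Suc n))\<bar>)"
    and "(\<lambda>n. f (int (Suc n))) sums s" "(\<lambda>n. f (- int (Suc n))) sums t"
  shows "(f has_sum (f 0 + s + t)) UNIV"
proof -
  let ?P = "range (\<lambda>n. int (Suc n))" and ?N = "range (\<lambda>n. - int (Suc n))"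
  have pos: "(f has_sum s) ?P"
    using norm_summable_imp_has_sum[of "\<lambda>n. f (int (Suc n))"] assms
    by (subst has_sum_reindex) (auto simp: inj_on_def o_def)
  have neg: "(f has_sum t) ?N"
    using norm_summable_imp_has_sum[of "\<lambda>n. f (- int (Suc n))"] assms
    by (subst has_sum_reindex) (auto simp: inj_on_def o_def)
  have "(f has_sum (f 0 + s + t)) (({0} \<union> ?P) \<union> ?N)"
    by (intro has_sum_Un_disjoint pos neg) (auto intro: has_sum_finiteI)
  moreover have "({0} \<union> ?P) \<union> ?N = UNIV"
  proof -
    have "x \<in> {0} \<union> ?P \<union> ?N" for x :: int
    proof (cases x rule: int_cases3)
      case (pos n)
      then have "x = int (Suc (n - 1))" by simp
      then show ?thesis by blast
    next
      case (neg n)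
      then have "x = - int (Suc (n - 1))" by simp
      then show ?thesis by blast
    qed simp
    then show ?thesis by blast
  qed
  ultimately show ?thesis by simp
qed

text \<open>Converse use of \<open>has_sum_int_split\<close>: unconditional summability over the
  integers makes both halves absolutely summable, so their values may be computed as ordinary
  ordered series.\<close>

lemma has_sum_int_unsplit:
  fixes f :: "int \<Rightarrow> real"
  assumes "(f has_sum S) UNIV"
    and "(\<lambda>n. f (int (Suc n))) sums s" "(\<lambda>n. f (- int (Suc n))) sums t"
  shows "S = f 0 + s + t"
proof -
  have abs: "(\<lambda>n. \<bar>f n\<bar>) summable_on UNIV"
    using summable_on_iff_abs_summable_on_real[THEN iffD1, OF has_sum_imp_summable[OF assms(1)]] by simp
  have "summable (\<lambda>n. \<bar>f (g n)\<bar>)" if "inj g" for g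
    using summable_on_subset[OF abs, of "range g"] summable_on_reindex[OF that, of "\<lambda>n. \<bar>f n\<bar>"]
    by (auto intro: summable_on_imp_summable simp: o_def)
  then have "(f has_sum (f 0 + s + t)) UNIV"
    by (intro has_sum_int_split assms) (auto simp: inj_on_def)
  then show ?thesis using assms(1) has_sum_unique by blast
qed

lemma has_sum_int_shift:
  fixes f :: "int \<Rightarrow> real"
  shows "((\<lambda>n. f (n + c)) has_sum s) UNIV \<longleftrightarrow> (f has_sum s) UNIV"
  by (rule has_sum_reindex_bij_witness[of _ "\<lambda>n. n - c" "\<lambda>n. n + c"]) auto

text \<open>Once summability is given, the sum can be computed along the symmetric intervals, where
  it telescopes to \<open>f (int N) - f (- int (Suc N))\<close>.\<close>

lemma has_sum_int_telescope:
  fixes f :: "int \<Rightarrow> real"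
  assumes "(\<lambda>n. f (int n)) \<longlonglongrightarrow> 0" "(\<lambda>n. f (- int n)) \<longlonglongrightarrow> 0"
    and "(\<lambda>n. f n - f (n - 1)) summable_on UNIV"
  shows "((\<lambda>n. f n - f (n - 1)) has_sum 0) UNIV"
proof -
  let ?g = "\<lambda>n. f n - f (n - 1)"
  obtain s where s: "(?g has_sum s) UNIV" using assms(3) by (auto simp: summable_on_def)
  \<comment> \<open>The symmetric intervals eventually contain every finite set of integers, so the
    limit along finite subsets may be taken along them.\<close>
  have "filterlim (\<lambda>N. {- int N..int N}) (finite_subsets_at_top UNIV) sequentially"
    unfolding filterlim_finite_subsets_at_top
  proof safe
    fix X :: "int set" assume "finite X"
    then obtain B where B: "\<forall>x\<in>X. \<bar>x\<bar> \<le> B"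
      using finite_imageI[of X abs] by (metis Max_ge imageI)
    show "\<forall>\<^sub>F N in sequentially. finite {- int N..int N} \<and> X \<subseteq> {- int N..int N} \<and> {- int N..int N} \<subseteq> UNIV"
      using eventually_ge_at_top[of "nat B"] by eventually_elim (use B in force)
  qed
  then have "(\<lambda>N. sum ?g {- int N..int N}) \<longlonglongrightarrow> s"
    using s unfolding has_sum_def by (rule filterlim_compose[rotated])
  moreover have "sum ?g {- int N..int N} = f (int N) - f (- int (Suc N))" for N
  proof (induction N)
    case (Suc N)
    have "{- int (Suc N)..int (Suc N)} = insert (int (Suc N)) (insert (- int (Suc N)) {- int N..int N})"
      by auto
    then show ?case using Suc by simp
  qed simp
  moreover have "(\<lambda>N. f (int N) - f (- int (Suc N))) \<longlonglongrightarrow> 0 - 0"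
    by (intro tendsto_diff assms LIMSEQ_Suc)
  ultimately have "s = 0" using LIMSEQ_unique by fastforce
  then show ?thesis using s by simp
qed

subsection \<open>Harmonic numbers on the integers\<close>

text \<open>The difference equation \<open>harm_int_diff\<close> relies on \<open>1 / 0 = 0\<close> at \<open>n = 1\<close>.\<close>

definition harm_int :: "int \<Rightarrow> real" where
  "harm_int n = zeta_part (nat (if n > 0 then n - 1 else - n)) 1"

lemma harm_int_0 [simp]: "harm_int 0 = 0"
  by (simp add: harm_int_def)

lemma harm_int_pos: "harm_int (int (Suc n)) = zeta_part (Suc n) 1 - 1 / real (Suc n)"
  by (simp add: harm_int_def zeta_part_Suc)

lemma harm_int_neg: "harm_int (- int n) = zeta_part n 1"
  by (simp add: harm_int_def)

lemma harm_int_nonneg: "harm_int n \<ge> 0"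
  by (simp add: harm_int_def zeta_part_nonneg)

lemma harm_int_diff: "harm_int n - harm_int (n - 1) = 1 / of_int (n - 1)"
proof -
  consider "n \<ge> 2" | "n = 1" | "n \<le> 0" by linarith
  then show ?thesis
  proof cases
    case 1
    then have "nat (n - 1) = Suc (nat (n - 2))" by linarith
    then show ?thesis using 1 by (simp add: harm_int_def zeta_part_Suc)
  next
    case 3
    then have "nat (1 - n) = Suc (nat (- n))" by linarith
    then show ?thesis using 3 by (simp add: harm_int_def zeta_part_Suc field_simps)
  qed (simp add: harm_int_def)
qed

lemma harm_int_le_sqrt: "harm_int n \<le> 2 * sqrt \<bar>of_int n\<bar>"
proof -
  have "harm_int n \<le> 2 * sqrt (nat (if n > 0 then n - 1 else - n))"
    unfolding harm_int_def by (rule zeta_part_1_le_sqrt)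
  also have "\<dots> \<le> 2 * sqrt \<bar>of_int n\<bar>" by simp
  finally show ?thesis .
qed

lemma has_sum_inverse_power_int:
  assumes "k \<ge> 2"
  shows "((\<lambda>n::int. 1 / of_int n ^ k) has_sum ((1 + (-1) ^ k) * zeta_value k)) UNIV"
proof -
  have "((\<lambda>n::int. 1 / of_int n ^ k) has_sum
      (1 / of_int 0 ^ k + zeta_value k + (-1) ^ k * zeta_value k)) UNIV"
  proof (rule has_sum_int_split)
    have *: "1 / real_of_int (- int (Suc n)) ^ k = (-1) ^ k * (1 / real (Suc n) ^ k)" for n
      using power_minus[of "real (Suc n)" k] by (cases "even k") simp_all
    show "(\<lambda>n. 1 / real_of_int (- int (Suc n)) ^ k) sums ((-1) ^ k * zeta_value k)"
      unfolding * by (intro sums_mult zeta_value_sums assms)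
    show "summable (\<lambda>n. \<bar>1 / real_of_int (- int (Suc n)) ^ k\<bar>)"
      unfolding * using summable_zeta_value[OF assms] by (simp add: abs_mult)
  qed (use zeta_value_sums[OF assms] summable_zeta_value[OF assms] in simp_all)
  then show ?thesis using assms by (simp add: algebra_simps power_0_left)
qed

text \<open>The positive half uses \<open>H_n - 1 / n\<close>, whence the term
  \<open>zeta_value (Suc k)\<close>; the negative half uses \<open>H_n\<close> itself with the sign
  \<open>(-1) ^ k\<close>.\<close>

lemma has_sum_harm_int_div_power:
  assumes "k \<ge> 2"
  shows "((\<lambda>n. harm_int n / of_int n ^ k) has_sum
    ((1 + (-1) ^ k) * linear_sum 1 k - zeta_value (Suc k))) UNIV"
proof -
  have pos: "(\<lambda>n. harm_int (int (Suc n)) / real_of_int (int (Suc n)) ^ k) sums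
      (linear_sum 1 k - zeta_value (Suc k))"
    using sums_diff[OF linear_sum_sums[of 1 k] zeta_value_sums[of "Suc k"]] assms
    by (simp only: harm_int_pos of_int_of_nat_eq) (simp add: diff_divide_distrib)
  have *: "harm_int (- int (Suc n)) / real_of_int (- int (Suc n)) ^ k
      = (-1) ^ k * (zeta_part (Suc n) 1 / real (Suc n) ^ k)" for n
    using power_minus[of "real (Suc n)" k] by (cases "even k") (simp_all only: harm_int_neg, simp_all)
  have neg: "(\<lambda>n. harm_int (- int (Suc n)) / real_of_int (- int (Suc n)) ^ k) sums
      ((-1) ^ k * linear_sum 1 k)"
    unfolding * by (intro sums_mult linear_sum_sums) (use assms in auto)
  have "((\<lambda>n. harm_int n / of_int n ^ k) has_sum (harm_int 0 / of_int 0 ^ k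
      + (linear_sum 1 k - zeta_value (Suc k)) + (-1) ^ k * linear_sum 1 k)) UNIV"
  proof (rule has_sum_int_split[OF _ _ pos neg])
    show "summable (\<lambda>n. \<bar>harm_int (int (Suc n)) / real_of_int (int (Suc n)) ^ k\<bar>)"
      using sums_summable[OF pos] by (simp add: harm_int_nonneg)
    show "summable (\<lambda>n. \<bar>harm_int (- int (Suc n)) / real_of_int (- int (Suc n)) ^ k\<bar>)"
      unfolding * using summable_linear_sum[of 1 k] assms
      by (simp add: abs_mult zeta_part_nonneg)
  qed
  then show ?thesis by (simp add: algebra_simps)
qed

text \<open>For nonzero \<open>n + c\<close> one has
  \<open>\<bar>n\<bar> \<le> (1 + \<bar>c\<bar>) * \<bar>n + c\<bar>\<close>, so a power of the
  shifted factor can be traded for the same power of \<open>n\<close>. If the denominator is 0, the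
  left side is 0 by convention.\<close>

lemma inverse_shift_bound:
  assumes "a + b \<ge> 2" "n \<noteq> (0::int)"
  shows "1 / \<bar>real_of_int n ^ a * real_of_int (n + c) ^ b\<bar> \<le> (1 + \<bar>c\<bar>) ^ b * (1 / real_of_int n ^ 2)"
proof (cases "n + c = 0 \<and> b > 0")
  case True
  then show ?thesis by (simp add: power_0_left)
next
  case False
  define x y z where "x = \<bar>real_of_int n\<bar>" and "y = \<bar>real_of_int (n + c)\<bar>" and "z = 1 + \<bar>real_of_int c\<bar>"
  have x: "x \<ge> 1" using assms(2) unfolding x_def
    by (metis of_int_abs of_int_1_le_iff zero_less_abs_iff int_one_le_iff_zero_less)
  have xyz: "x ^ b \<le> z ^ b * y ^ b \<and> y ^ b > 0"
  proof (cases "b = 0")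
    case nz: False
    then have "n + c \<noteq> 0" using False by simp
    then have y: "y \<ge> 1" unfolding y_def
      by (metis of_int_abs of_int_1_le_iff zero_less_abs_iff int_one_le_iff_zero_less)
    have "x \<le> y + \<bar>real_of_int c\<bar>" unfolding x_def y_def by simp
    also have "\<dots> \<le> y + \<bar>real_of_int c\<bar> * y" using y by (simp add: mult_le_cancel_left1)
    finally have "x \<le> z * y" by (simp add: z_def algebra_simps)
    then show ?thesis using x y power_mono[of x "z * y" b] by (simp add: power_mult_distrib)
  qed simp
  have "x ^ 2 * 1 \<le> x ^ (a + b)" using x assms by (simp add: power_increasing)
  also have "\<dots> = x ^ a * x ^ b" by (simp add: power_add)
  also have "\<dots> \<le> x ^ a * (z ^ b * y ^ b)" using x xyz by (intro mult_left_mono) auto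
  finally have "1 / (x ^ a * y ^ b) \<le> z ^ b * (1 / x ^ 2)"
    using x xyz by (simp add: field_simps)
  then show ?thesis by (simp add: x_def y_def z_def abs_mult power_abs)
qed

text \<open>The terms with \<open>n + d = 0\<close> are excluded by \<open>1 / 0 = 0\<close> only if \<open>b > 0\<close>.\<close>

definition harm_term :: "nat \<Rightarrow> nat \<Rightarrow> nat \<Rightarrow> int \<Rightarrow> real" where
  "harm_term a b d n = harm_int n / (of_int n ^ a * of_int (n + int d) ^ b)"

text \<open>For \<open>a, b \<ge> 2\<close> and \<open>d \<ge> 1\<close> this is the part of the
  double sum with \<open>m - n = d\<close>.\<close>

definition harm_series :: "nat \<Rightarrow> nat \<Rightarrow> nat \<Rightarrow> real" where
  "harm_series a b d = infsum (harm_term a b d) UNIV"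

lemma harm_term_summable:
  assumes "a + b \<ge> 2" shows "harm_term a b d summable_on UNIV"
proof (rule summable_on_realI)
  show "(\<lambda>n. (1 + \<bar>int d\<bar>) ^ b * (harm_int n / of_int n ^ 2)) summable_on UNIV"
    by (intro summable_on_cmult_right has_sum_imp_summable[OF has_sum_harm_int_div_power]) simp
  fix n :: int
  show "\<bar>harm_term a b d n\<bar> \<le> (1 + \<bar>int d\<bar>) ^ b * (harm_int n / of_int n ^ 2)"
  \<comment> \<open>The majorant needs \<open>n \<noteq> 0\<close>. At \<open>n = 0\<close> the term
    vanishes even for \<open>a = 0\<close>, because \<open>harm_int 0 = 0\<close>.\<close>
  proof (cases "n = 0")
    case False
    from mult_left_mono[OF inverse_shift_bound[OF assms False, of "int d"] harm_int_nonneg[of n]]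
    show ?thesis
      by (simp add: harm_term_def abs_mult harm_int_nonneg mult_ac)
  qed (simp add: harm_term_def)
qed

lemma harm_series_has_sum:
  "a + b \<ge> 2 \<Longrightarrow> (harm_term a b d has_sum harm_series a b d) UNIV"
  unfolding harm_series_def by (rule has_sum_infsum[OF harm_term_summable])

section \<open>Rational functions summed over the integers\<close>

lemma inverse_shift_summable:
  assumes "k \<ge> 1"
  shows "(\<lambda>n. 1 / (real_of_int n ^ k * of_int (n + c))) summable_on UNIV"
proof (rule summable_on_realI)
  show "(\<lambda>n. (1 + \<bar>c\<bar>) ^ 1 * (1 / real_of_int n ^ 2)) summable_on UNIV"
    by (intro summable_on_cmult_right has_sum_imp_summable[OF has_sum_inverse_power_int]) simp
  fix n :: int
  show "\<bar>1 / (real_of_int n ^ k * of_int (n + c))\<bar> \<le> (1 + \<bar>c\<bar>) ^ 1 * (1 / real_of_int n ^ 2)"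
    using inverse_shift_bound[of k 1 n c] assms by (cases "n = 0") auto
qed

text \<open>Raising \<open>d\<close> by one adds a shifted copy of the differences of
  \<open>1 / n\<close>, and these telescope to 0.\<close>

lemma has_sum_inverse_diff: "((\<lambda>n::int. 1 / of_int (n - int d) - 1 / real_of_int n) has_sum 0) UNIV"
proof (induction d)
  case (Suc d)
  let ?f = "\<lambda>n::int. 1 / real_of_int n"
  \<comment> \<open>The identity \<open>1 / n - 1 / (n - 1) = - 1 / (n * (n - 1))\<close> fails only
    at the two poles, where the left side is 1 and the right side is 0; the indicator terms repair
    this.\<close>
  have "(\<lambda>n. - (1 / (real_of_int n ^ 1 * of_int (n + (- 1)))) + (if n = 0 then 1 else 0) + (if n = 1 then 1 else 0))
      summable_on UNIV"
    by (intro summable_on_add summable_on_uminus[THEN iffD2] inverse_shift_summable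
        has_sum_imp_summable[OF has_sum_single]) auto
  also have "(\<lambda>n. - (1 / (real_of_int n ^ 1 * of_int (n + (- 1)))) + (if n = 0 then 1 else 0) + (if n = 1 then 1 else 0))
      = (\<lambda>n. ?f n - ?f (n - 1))"
  proof (rule ext)
    fix n :: int
    consider "n = 0" | "n = 1" | "real_of_int n \<noteq> 0" "real_of_int n - 1 \<noteq> 0" by fastforce
    then show "- (1 / (real_of_int n ^ 1 * of_int (n + (- 1)))) + (if n = 0 then 1 else 0) + (if n = 1 then 1 else 0)
      = ?f n - ?f (n - 1)"
      by cases (auto simp: field_simps)
  qed
  finally have "((\<lambda>n. ?f n - ?f (n - 1)) has_sum 0) UNIV"
  proof (rule has_sum_int_telescope[rotated 2])
    show "(\<lambda>n. ?f (int n)) \<longlonglongrightarrow> 0" "(\<lambda>n. ?f (- int n)) \<longlonglongrightarrow> 0"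
      using lim_1_over_n[where 'a = real] tendsto_minus[OF lim_1_over_n[where 'a = real]] by simp_all
  qed
  then have "((\<lambda>n. ?f (n - int d) - ?f (n - int d - 1)) has_sum 0) UNIV"
    using has_sum_int_shift[of "\<lambda>n. ?f n - ?f (n - 1)" "- int d" 0] by (simp only: add_uminus_conv_diff)
  from has_sum_add[OF has_sum_uminusI[OF this] Suc]
  have "((\<lambda>n. - (?f (n - int d) - ?f (n - int d - 1)) + (?f (n - int d) - ?f n)) has_sum 0) UNIV"
    by simp
  moreover have "- (?f (n - int d) - ?f (n - int d - 1)) + (?f (n - int d) - ?f n)
      = ?f (n - int (Suc d)) - ?f n" for n
    by (simp only: of_nat_Suc diff_diff_eq add.commute[of 1])
  ultimately show ?case by (simp only:)
qed simp

text \<open>The terms \<open>m = 0\<close> and \<open>m = d\<close> vanish since \<open>1 / 0 = 0\<close>; each of them accounts for one \<open>1 / d\<^sup>2\<close>.\<close>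

lemma has_sum_inverse_shift_1:
  assumes "d \<ge> 1"
  shows "((\<lambda>m. 1 / (real_of_int m * of_int (m - int d))) has_sum (2 / real d ^ 2)) UNIV"
proof -
  have "((\<lambda>m. 1 / real d * (1 / of_int (m - int d) - 1 / real_of_int m)
      + (if m = 0 then 1 / real d ^ 2 else 0) + (if m = int d then 1 / real d ^ 2 else 0))
      has_sum (1 / real d * 0 + 1 / real d ^ 2 + 1 / real d ^ 2)) UNIV"
    by (intro has_sum_add has_sum_cmult_right has_sum_inverse_diff has_sum_single)
  also have "(\<lambda>m. 1 / real d * (1 / of_int (m - int d) - 1 / real_of_int m)
      + (if m = 0 then 1 / real d ^ 2 else 0) + (if m = int d then 1 / real d ^ 2 else 0))
      = (\<lambda>m. 1 / (real_of_int m * of_int (m - int d)))"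
    by (rule ext) (use assms in \<open>auto simp: divide_simps power2_eq_square\<close>)
  finally show ?thesis by simp
qed

text \<open>Recursion on \<open>k\<close> by \<open>1 / (m^(k+1) * (m - d)) = (1 / (m^k * (m - d)) -
  1 / m^(k+1)) / d\<close>. It fails only at \<open>m = d\<close>, where \<open>1 / d^(k+2)\<close>
  must be added. The coefficient of the leading power thus starts at 2 and grows by one in each
  step, giving \<open>k + 1\<close>.\<close>

lemma has_sum_inverse_shift:
  assumes "k \<ge> 1" "d \<ge> 1"
  shows "((\<lambda>m. 1 / (real_of_int m ^ k * of_int (m - int d))) has_sum
    (real (k + 1) / real d ^ (k + 1)
      - (\<Sum>j = 2..k. (1 + (-1) ^ j) * zeta_value j / real d ^ (k + 1 - j)))) UNIV"
  using assms(1)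
proof (induction k rule: dec_induct)
  case base
  then show ?case using has_sum_inverse_shift_1[OF assms(2)] by (simp add: power2_eq_square)
next
  case (step k)
  let ?s = "real (k + 1) / real d ^ (k + 1)
      - (\<Sum>j = 2..k. (1 + (-1) ^ j) * zeta_value j / real d ^ (k + 1 - j))"
  have "((\<lambda>m. 1 / real d * (1 / (real_of_int m ^ k * of_int (m - int d)) + - (1 / of_int m ^ Suc k))
      + (if m = int d then 1 / real d ^ (k + 2) else 0))
      has_sum (1 / real d * (?s + - ((1 + (-1) ^ Suc k) * zeta_value (Suc k))) + 1 / real d ^ (k + 2))) UNIV"
    by (intro has_sum_add has_sum_cmult_right has_sum_uminusI has_sum_single step.IH
        has_sum_inverse_power_int) (use step.hyps(1) in auto)
  also have "(\<lambda>m. 1 / real d * (1 / (real_of_int m ^ k * of_int (m - int d)) + - (1 / of_int m ^ Suc k))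
      + (if m = int d then 1 / real d ^ (k + 2) else 0))
      = (\<lambda>m. 1 / (real_of_int m ^ Suc k * of_int (m - int d)))"
  proof (rule ext)
    fix m
    show "1 / real d * (1 / (real_of_int m ^ k * of_int (m - int d)) + - (1 / of_int m ^ Suc k))
      + (if m = int d then 1 / real d ^ (k + 2) else 0) = 1 / (real_of_int m ^ Suc k * of_int (m - int d))"
    proof (cases "m = 0 \<or> m = int d")
      case False
      then have "real_of_int m \<noteq> 0" "real_of_int (m - int d) \<noteq> 0" "real_of_int (m - int d) = real_of_int m - real d" "real d \<noteq> 0"
        using assms by auto
      then show ?thesis using False by (simp add: divide_simps)
    qed (use assms step.hyps(1) in auto)
  qed
  also have "1 / real d * (?s + - ((1 + (-1) ^ Suc k) * zeta_value (Suc k))) + 1 / real d ^ (k + 2)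
    = real (Suc k + 1) / real d ^ (Suc k + 1)
      - (\<Sum>j = 2..Suc k. (1 + (-1) ^ j) * zeta_value j / real d ^ (Suc k + 1 - j))"
  proof -
    have "(\<Sum>j = 2..Suc k. (1 + (-1) ^ j) * zeta_value j / real d ^ (Suc k + 1 - j))
      = (\<Sum>j = 2..k. (1 + (-1) ^ j) * zeta_value j / real d ^ (k + 1 - j)) / real d
        + (1 + (-1) ^ Suc k) * zeta_value (Suc k) / real d"
    proof -
      have "(\<Sum>j = 2..k. (1 + (-1) ^ j) * zeta_value j / real d ^ (Suc k + 1 - j))
        = (\<Sum>j = 2..k. (1 + (-1) ^ j) * zeta_value j / real d ^ (k + 1 - j) / real d)"
        by (rule sum.cong) (auto simp: Suc_diff_le)
      then show ?thesis using step.hyps(1) by (simp add: sum_divide_distrib)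
    qed
    moreover have "1 / r * (x / r ^ (k + 1) - S + - z) + 1 / r ^ (k + 2)
        = (x + 1) / r ^ (k + 2) - (S / r + z / r)" for r x z S :: real
      by (simp add: add_divide_distrib diff_divide_distrib)
    moreover have "Suc k + 1 = k + 2" "real (Suc k + 1) = real (k + 1) + 1" by simp_all
    ultimately show ?thesis by (simp only:)
  qed
  finally show ?case .
qed

subsection \<open>Partial fractions\<close>

text \<open>
  Functions of \<open>d = Suc n\<close>. The parameter bounds the exponent of \<open>1 / d\<close> from below, which is what makes
  the sum over \<open>d\<close> converge when it is at least \<open>2\<close>.
\<close>

inductive harmonic_span :: "nat \<Rightarrow> (nat \<Rightarrow> real) \<Rightarrow> bool" for q where
  power: "k \<ge> q \<Longrightarrow> harmonic_span q (\<lambda>n. 1 / real (Suc n) ^ k)"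
| zeta_part: "k \<ge> q \<Longrightarrow> j \<ge> 1 \<Longrightarrow> harmonic_span q (\<lambda>n. zeta_part (Suc n) j / real (Suc n) ^ k)"
| add: "harmonic_span q f \<Longrightarrow> harmonic_span q g \<Longrightarrow> harmonic_span q (\<lambda>n. f n + g n)"
| scale: "reducible_to_linear_sums c \<Longrightarrow> harmonic_span q f \<Longrightarrow> harmonic_span q (\<lambda>n. c * f n)"

lemma harmonic_span_const: "reducible_to_linear_sums c \<Longrightarrow> harmonic_span 0 (\<lambda>n. c)"
  using harmonic_span.scale[OF _ harmonic_span.power[of 0 0]] by simp

lemma harmonic_span_diff:
  assumes "harmonic_span q f" "harmonic_span q g"
  shows "harmonic_span q (\<lambda>n. f n - g n)"
  using harmonic_span.add[OF assms(1) harmonic_span.scale[OF reducible_of_int[of "-1"] assms(2)]]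
  by simp

lemma harmonic_span_sum:
  assumes "\<And>i. i \<in> I \<Longrightarrow> harmonic_span 0 (f i)"
  shows "harmonic_span 0 (\<lambda>n. \<Sum>i\<in>I. f i n)"
  using assms
proof (induction I rule: infinite_finite_induct)
  case (insert i I)
  then show ?case by (simp add: harmonic_span.add)
qed (use harmonic_span_const[of 0] reducible_of_int[of 0] in simp_all)

lemma harmonic_span_mono:
  assumes "harmonic_span q f" "r \<le> q"
  shows "harmonic_span r f"
  using assms by (induction rule: harmonic_span.induct) (simp_all add: harmonic_span.intros del: of_nat_Suc)

text \<open>Each division by \<open>d\<close> in a partial fraction step raises the lower bound on
  the exponent by one.\<close>

lemma harmonic_span_divide:
  assumes "harmonic_span q f"
  shows "harmonic_span (Suc q) (\<lambda>n. f n / real (Suc n))"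
  using assms
proof (induction rule: harmonic_span.induct)
  case (power k)
  then show ?case using harmonic_span.power[of "Suc q" "Suc k"] by (simp add: mult.commute)
next
  case (zeta_part k j)
  then show ?case using harmonic_span.zeta_part[of "Suc q" "Suc k" j] by (simp add: mult.commute)
next
  case (add f g)
  then show ?case using harmonic_span.add by (fastforce simp: add_divide_distrib)
next
  case (scale c f)
  then show ?case using harmonic_span.scale[of c "Suc q" "\<lambda>n. f n / real (Suc n)"] by simp
qed

text \<open>With exponents at least 2 every generator sums to a zeta value or a linear sum, and
  reducible coefficients preserve reducibility.\<close>

lemma harmonic_span_sums:
  assumes "harmonic_span 2 f"
  shows "\<exists>s. f sums s \<and> reducible_to_linear_sums s"
  using assms
proof (induction rule: harmonic_span.induct)
  case (power k)
  then show ?case using zeta_value_sums reducible_zeta_value by blast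
next
  case (zeta_part k j)
  then show ?case using linear_sum_sums reducible_linear_sum by blast
next
  case (add f g)
  then show ?case using sums_add reducible_add by blast
next
  case (scale c f)
  then show ?case using sums_mult reducible_mult by blast
qed

section \<open>Base cases: one exponent 0, or both exponents 1\<close>

lemma reducible_two_sided_zeta:
  "k \<ge> 2 \<Longrightarrow> reducible_to_linear_sums ((1 + (-1) ^ k) * zeta_value k)"
  using reducible_mult[OF reducible_of_int[of "1 + (-1) ^ k"] reducible_zeta_value] by simp

lemma harm_series_right_0:
  assumes "k \<ge> 2" shows "harm_series k 0 d = (1 + (-1) ^ k) * linear_sum 1 k - zeta_value (Suc k)"
  using infsumI[OF has_sum_harm_int_div_power[OF assms]]
  by (simp add: harm_series_def harm_term_def[abs_def])

lemma reducible_harm_series_right_0: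
  assumes "k \<ge> 2" shows "reducible_to_linear_sums (harm_series k 0 d)"
proof -
  have "reducible_to_linear_sums (of_int (1 + (-1) ^ k) * linear_sum 1 k - zeta_value (Suc k))"
    using assms
    by (intro reducible_diff reducible_mult reducible_of_int reducible_linear_sum reducible_zeta_value) auto
  then show ?thesis using assms by (simp add: harm_series_right_0)
qed

text \<open>After the substitution \<open>m = n + d\<close> the dependence on \<open>d\<close> sits
  in \<open>harm_int (m - d)\<close>, whose difference is a reciprocal. What remains is a rational
  sum given by \<open>has_sum_inverse_shift\<close>.\<close>

lemma harm_series_left_0_diff:
  assumes "k \<ge> 2"
  shows "harm_series 0 k d - harm_series 0 k (Suc d) = real (k + 1) / real (Suc d) ^ (k + 1)
      - (\<Sum>j = 2..k. (1 + (-1) ^ j) * zeta_value j / real (Suc d) ^ (k + 1 - j))"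
proof -
  have *: "((\<lambda>m. harm_int (m - int e) / of_int m ^ k) has_sum harm_series 0 k e) UNIV" for e
    using harm_series_has_sum[of 0 k e] assms
      has_sum_int_shift[of "harm_term 0 k e" "- int e" "harm_series 0 k e"]
    by (simp add: harm_term_def)
  have "((\<lambda>m. harm_int (m - int d) / of_int m ^ k + - (harm_int (m - int (Suc d)) / of_int m ^ k))
      has_sum (harm_series 0 k d + - harm_series 0 k (Suc d))) UNIV"
    by (intro has_sum_add has_sum_uminusI *)
  also have "(\<lambda>m. harm_int (m - int d) / of_int m ^ k + - (harm_int (m - int (Suc d)) / of_int m ^ k))
      = (\<lambda>m. 1 / (real_of_int m ^ k * of_int (m - int (Suc d))))"
  proof (rule ext)
    fix m
    have "harm_int (m - int d) - harm_int (m - int (Suc d)) = 1 / of_int (m - int (Suc d))"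
      using harm_int_diff[of "m - int d"] by (simp add: algebra_simps)
    then show "harm_int (m - int d) / of_int m ^ k + - (harm_int (m - int (Suc d)) / of_int m ^ k)
      = 1 / (real_of_int m ^ k * of_int (m - int (Suc d)))"
      by (metis (no_types, opaque_lifting) diff_conv_add_uminus diff_divide_distrib divide_divide_eq_left mult.commute)
  qed
  finally show ?thesis
    using has_sum_unique[OF _ has_sum_inverse_shift[of k "Suc d"]] assms by fastforce
qed

text \<open>Summing the differences turns each power of \<open>1 / d\<close> into a partial zeta
  sum; at \<open>d = 0\<close> the two kinds of series coincide.\<close>

lemma harm_series_left_0:
  assumes "k \<ge> 2"
  shows "harm_series 0 k d = harm_series k 0 0 - real (k + 1) * zeta_part d (k + 1)
      + (\<Sum>j = 2..k. (1 + (-1) ^ j) * zeta_value j * zeta_part d (k + 1 - j))"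
proof (induction d)
  case 0
  then show ?case by (simp add: harm_series_def harm_term_def[abs_def])
next
  case (Suc d)
  then show ?case using harm_series_left_0_diff[OF assms, of d]
    by (simp add: zeta_part_Suc algebra_simps sum.distrib)
qed

text \<open>Here the two partial fractions are not summable separately, so their difference is kept
  together. At \<open>n = - d\<close> the convention \<open>1 / 0 = 0\<close> breaks the
  decomposition, and the last summand compensates.\<close>

lemma harm_term_1_1:
  assumes "d \<ge> 1"
  shows "harm_term 1 1 d n = - (1 / real d) * (harm_int n * (1 / of_int (n + int d) - 1 / of_int n))
    + (if n = - int d then zeta_part d 1 / real d ^ 2 else 0)"
proof (cases "n = 0 \<or> n = - int d")
  case False
  then have "real_of_int n \<noteq> 0" "real_of_int (n + int d) \<noteq> 0" "real_of_int (n + int d) = real_of_int n + real d" "real d \<noteq> 0"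
    using assms by auto
  then show ?thesis using False by (simp add: harm_term_def divide_simps)
qed (use assms in \<open>auto simp: harm_term_def harm_int_neg power2_eq_square\<close>)

text \<open>Induction on \<open>d\<close>: the increment is a telescoping difference minus a
  rational function with sum \<open>2 / (d + 1)^2\<close>, so the increments add up to a multiple of
  \<open>zeta_part d 2\<close>.\<close>

lemma has_sum_harm_int_inverse_diff:
  "((\<lambda>n. harm_int n * (1 / of_int (n + int d) - 1 / of_int n)) has_sum (- 2 * zeta_part d 2)) UNIV"
proof (induction d)
  case (Suc d)
  let ?g = "\<lambda>d n. harm_int n * (1 / of_int (n + int d) - 1 / of_int n)"
  let ?f = "\<lambda>n. harm_int n / of_int (n + int (Suc d))"
  have pair: "((\<lambda>n. 1 / (real_of_int (n + int d) * of_int (n - 1))) has_sum (2 / real (Suc d) ^ 2)) UNIV"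
    using has_sum_inverse_shift_1[of "Suc d"]
      has_sum_int_shift[of "\<lambda>m. 1 / (real_of_int m * of_int (m - int (Suc d)))" "int d"]
    by (simp add: algebra_simps)
  \<comment> \<open>Summation by parts: \<open>harm_int n\<close> is replaced by
    \<open>harm_int (n - 1) + 1 / (n - 1)\<close> in the term with denominator
    \<open>n + d\<close>.\<close>
  have step: "?g (Suc d) n + - ?g d n = (?f n - ?f (n - 1)) + - (1 / (real_of_int (n + int d) * of_int (n - 1)))" for n
  proof -
    have h: "harm_int n = harm_int (n - 1) + 1 / of_int (n - 1)" using harm_int_diff[of n] by simp
    have "n - 1 + int (Suc d) = n + int d" by simp
    moreover have "(x + y) * (p - r) + - ((x + y) * (q - r)) = (x + y) * p - x * q + - (q * y)"
      for x y p q r :: real by (simp add: algebra_simps)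
    ultimately show ?thesis
      unfolding h divide_inverse mult_1 inverse_mult_distrib by (simp only:)
  qed
  have "?g (Suc d) summable_on UNIV"
  proof -
    have "(\<lambda>n. - real (Suc d) * (harm_term 1 1 (Suc d) n
        + - (if n = - int (Suc d) then zeta_part (Suc d) 1 / real (Suc d) ^ 2 else 0))) summable_on UNIV"
      by (intro summable_on_cmult_right summable_on_add harm_term_summable summable_on_uminus[THEN iffD2]
          has_sum_imp_summable[OF has_sum_single]) simp
    also have "(\<lambda>n. - real (Suc d) * (harm_term 1 1 (Suc d) n
        + - (if n = - int (Suc d) then zeta_part (Suc d) 1 / real (Suc d) ^ 2 else 0))) = ?g (Suc d)"
      by (rule ext) (subst harm_term_1_1, simp_all del: of_nat_Suc)
    finally show ?thesis .
  qed
  \<comment> \<open>Telescoping requires summability of the differences of \<open>?f\<close>; it is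
    read off from the other terms of \<open>step\<close>.\<close>
  then have "(\<lambda>n. ?g (Suc d) n + - ?g d n + 1 / (real_of_int (n + int d) * of_int (n - 1))) summable_on UNIV"
    by (intro summable_on_add summable_on_uminus[THEN iffD2] has_sum_imp_summable[OF Suc.IH] has_sum_imp_summable[OF pair])
  then have "(\<lambda>n. ?f n - ?f (n - 1)) summable_on UNIV"
    unfolding step by simp
  then have "((\<lambda>n. ?f n - ?f (n - 1)) has_sum 0) UNIV"
  proof (rule has_sum_int_telescope[rotated 2])
    have lim: "(\<lambda>n. 4 * inverse (sqrt (real n))) \<longlonglongrightarrow> 0"
      by (intro tendsto_mult_right_zero tendsto_inverse_0_at_top
          filterlim_compose[OF sqrt_at_top filterlim_real_sequentially])
    have bound: "norm (?f x) \<le> 4 * inverse (sqrt (real n))"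
      if n: "n > 2 * Suc d" and x: "\<bar>x\<bar> = int n" for n x
    proof -
      have *: "\<bar>real_of_int x\<bar> = real n" using x by (metis of_int_abs of_int_of_nat_eq)
      \<comment> \<open>Once \<open>n\<close> exceeds twice the shift, the denominator is at least
        \<open>n / 2\<close>, so the square-root bound on the numerator yields decay like
        \<open>4 / sqrt n\<close>.\<close>
      have "r / 2 \<le> \<bar>y + c\<bar>" if "2 * c < r" "\<bar>y\<bar> = r" "0 \<le> c" for r y c :: real
        using that by linarith
      from this[of "real (Suc d)" "real n" "real_of_int x"]
      have "real n / 2 \<le> \<bar>real_of_int (x + int (Suc d))\<bar>" using n * by simp
      then have "norm (?f x) \<le> 2 * sqrt (real n) / (real n / 2)"
        using harm_int_le_sqrt[of x] harm_int_nonneg[of x] n *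
        unfolding real_norm_def abs_divide by (intro frac_le) auto
      also have "\<dots> = 4 * (sqrt (real n) / real n)" by simp
      also have "sqrt (real n) / real n = inverse (sqrt (real n))"
        by (simp add: sqrt_divide_self_eq)
      finally show ?thesis .
    qed
    show "(\<lambda>n. ?f (int n)) \<longlonglongrightarrow> 0"
      by (rule Lim_null_comparison[OF _ lim])
        (use eventually_gt_at_top[of "2 * Suc d"] in eventually_elim, rule bound, auto)
    show "(\<lambda>n. ?f (- int n)) \<longlonglongrightarrow> 0"
      by (rule Lim_null_comparison[OF _ lim])
        (use eventually_gt_at_top[of "2 * Suc d"] in eventually_elim, rule bound, auto)
  qed
  from has_sum_add[OF this has_sum_uminusI[OF pair]]
  have "((\<lambda>n. ?g (Suc d) n + - ?g d n) has_sum (0 + - (2 / real (Suc d) ^ 2))) UNIV"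
    unfolding step .
  from has_sum_add[OF this Suc.IH] show ?case
    by (simp add: zeta_part_Suc algebra_simps)
qed simp

lemma harm_series_1_1:
  assumes "d \<ge> 1"
  shows "harm_series 1 1 d = 2 * zeta_part d 2 / real d + zeta_part d 1 / real d ^ 2"
proof -
  have "(harm_term 1 1 d has_sum
      (- (1 / real d) * (- 2 * zeta_part d 2) + zeta_part d 1 / real d ^ 2)) UNIV"
    unfolding harm_term_1_1[OF assms, abs_def]
    by (intro has_sum_add has_sum_cmult_right has_sum_harm_int_inverse_diff has_sum_single)
  then show ?thesis unfolding harm_series_def by (simp add: infsumI)
qed

text \<open>Partial fractions lower one exponent at a time; \<open>a + b \<ge> 1\<close> keeps both
  resulting series convergent. Only for \<open>b = 0\<close> does the term \<open>n = - d\<close>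
  survive on the right although it is 0 on the left, hence the correction.\<close>

lemma harm_series_step:
  assumes "d \<ge> 1" "a + b \<ge> 1"
  shows "harm_series (Suc a) (Suc b) d = (harm_series (Suc a) b d - harm_series a (Suc b) d) / real d
    - (if b = 0 then (-1) ^ Suc a * (zeta_part d 1 / real d ^ (a + 2)) else 0)"
proof -
  let ?c = "if b = 0 then (-1) ^ Suc a * (zeta_part d 1 / real d ^ (a + 2)) else 0"
  have "((\<lambda>n. 1 / real d * (harm_term (Suc a) b d n + - harm_term a (Suc b) d n)
        + - (if n = - int d then ?c else 0))
      has_sum (1 / real d * (harm_series (Suc a) b d + - harm_series a (Suc b) d) + - ?c)) UNIV"
    by (intro has_sum_add has_sum_cmult_right has_sum_uminusI has_sum_single harm_series_has_sum)
      (use assms in auto)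
  also have "(\<lambda>n. 1 / real d * (harm_term (Suc a) b d n + - harm_term a (Suc b) d n)
        + - (if n = - int d then ?c else 0)) = harm_term (Suc a) (Suc b) d"
  proof (rule ext)
    fix n
    consider "n \<noteq> 0" "n \<noteq> - int d" | "n = 0" | "n = - int d" by blast
    then show "1 / real d * (harm_term (Suc a) b d n + - harm_term a (Suc b) d n)
        + - (if n = - int d then ?c else 0) = harm_term (Suc a) (Suc b) d n"
    proof cases
      case 1
      then have "real_of_int n \<noteq> 0" "real_of_int (n + int d) \<noteq> 0"
        "real_of_int (n + int d) = real_of_int n + real d" "real d \<noteq> 0"
        using assms by auto
      then show ?thesis using 1 by (simp add: harm_term_def divide_simps) (simp add: algebra_simps)
    next
      case 2
      then show ?thesis using assms by (simp add: harm_term_def)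
    next
      case 3
      have "(- real d) ^ Suc a = (-1) ^ Suc a * real d ^ Suc a" by (rule power_minus)
      then show ?thesis using 3 assms
        by (cases "even a") (simp_all add: harm_term_def harm_int_neg power_0_left)
    qed
  qed
  finally show ?thesis
    unfolding harm_series_def[of "Suc a" "Suc b"] by (simp add: infsumI)
qed

text \<open>Induction on \<open>a + b\<close>. Lowering either exponent decreases
  \<open>min a b\<close> by at most one, and the division by \<open>d\<close> in
  \<open>harm_series_step\<close> restores it.\<close>

lemma harmonic_span_harm_series:
  assumes "a + b \<ge> 2"
  shows "harmonic_span (min a b) (\<lambda>n. harm_series a b (Suc n))"
  using assms
proof (induction "a + b" arbitrary: a b rule: less_induct)
  case less
  show ?case
  proof (cases a)
    case 0
    have k: "b \<ge> 2" using less 0 by simp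
    have zp: "harmonic_span 0 (\<lambda>n. zeta_part (Suc n) j)" if "j \<ge> 1" for j
      using harmonic_span.zeta_part[of 0 0 j] that by simp
    have "harmonic_span 0 (\<lambda>n. harm_series b 0 0 - of_int (int (b + 1)) * zeta_part (Suc n) (b + 1)
      + (\<Sum>j = 2..b. (1 + (-1) ^ j) * zeta_value j * zeta_part (Suc n) (b + 1 - j)))"
      by (intro harmonic_span.add harmonic_span_diff harmonic_span_const harmonic_span_sum
          harmonic_span.scale zp reducible_two_sided_zeta reducible_of_int reducible_harm_series_right_0)
        (use k in auto)
    then show ?thesis using 0 k by (simp add: harm_series_left_0)
  next
    case a: (Suc a')
    show ?thesis
    proof (cases b)
      case 0
      then have "a \<ge> 2" using less.prems by simp
      then have "harm_series a 0 (Suc n) = harm_series a 0 0" for n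
        by (simp add: harm_series_right_0)
      then show ?thesis
        using 0 harmonic_span_const[OF reducible_harm_series_right_0[OF \<open>a \<ge> 2\<close>]] by simp
    next
      case b: (Suc b')
      show ?thesis
      proof (cases "a' + b' \<ge> 1")
        case True
        have "harmonic_span (min a b') (\<lambda>n. harm_series a b' (Suc n))"
          "harmonic_span (min a' b) (\<lambda>n. harm_series a' b (Suc n))"
          using less.hyps[of a b'] less.hyps[of a' b] a b True by simp_all
        then have "harmonic_span (min a' b') (\<lambda>n. harm_series a b' (Suc n) - harm_series a' b (Suc n))"
          using a b by (intro harmonic_span_diff) (erule harmonic_span_mono, simp)+
        from harmonic_span_divide[OF this]
        have main: "harmonic_span (min a b)
            (\<lambda>n. (harm_series a b' (Suc n) - harm_series a' b (Suc n)) / real (Suc n))"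
          using a b by simp
        have corr: "harmonic_span (min a b)
            (\<lambda>n. of_int ((-1) ^ Suc a') * (zeta_part (Suc n) 1 / real (Suc n) ^ (a' + 2)))" 
          using a b by (intro harmonic_span.scale reducible_of_int harmonic_span.zeta_part) auto
        show ?thesis
        proof (cases "b' = 0")
          case b': True
          show ?thesis using harmonic_span_diff[OF main corr] a b True b' harm_series_step[of "Suc _" a' b']
            by (simp del: of_nat_Suc)
        next
          case False
          then show ?thesis using main a b True harm_series_step[of "Suc _" a' b']
            by (simp del: of_nat_Suc)
        qed
      next
        case False
        then have ab: "a = 1" "b = 1" using a b by auto
        have "harmonic_span 1 (\<lambda>n. of_int 2 * (zeta_part (Suc n) 2 / real (Suc n) ^ 1)
            + zeta_part (Suc n) 1 / real (Suc n) ^ 2)"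
          by (intro harmonic_span.add harmonic_span.scale harmonic_span.zeta_part reducible_of_int) auto
        then show ?thesis unfolding ab by (simp add: harm_series_1_1[simplified])
      qed
    qed
  qed
qed

subsection \<open>Splitting by signs\<close>

lemma zeta_tail_sums_nonneg:
  assumes "b \<ge> 2"
  shows "(\<lambda>d. 1 / real_of_int (int k + int (Suc d)) ^ b) sums (zeta_value b - zeta_part k b)"
proof (induction k)
  case 0
  then show ?case using zeta_value_sums[OF assms] by simp
next
  case (Suc k)
  have "(\<lambda>d. 1 / real_of_int (int k + int (Suc (Suc d))) ^ b) sums
      (zeta_value b - zeta_part k b - 1 / real_of_int (int k + int (Suc 0)) ^ b)"
    using Suc by (subst sums_Suc_iff) simp
  then show ?case by (simp add: zeta_part_Suc algebra_simps)
qed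

text \<open>Starting from \<open>n = - (k + 1)\<close>, the denominators run through
  \<open>-k, ..., -1\<close>, which give the signed partial sum, then 0, which contributes nothing,
  and then all positive integers.\<close>

lemma zeta_tail_sums_neg:
  assumes "b \<ge> 2"
  shows "(\<lambda>d. 1 / real_of_int (- int (Suc k) + int (Suc d)) ^ b) sums
    (zeta_value b + (-1) ^ b * zeta_part k b)"
proof (induction k)
  case 0
  have "(\<lambda>d. 1 / real d ^ b) sums zeta_value b"
    using zeta_value_sums[OF assms] sums_Suc_iff[of "\<lambda>d. 1 / real d ^ b"] assms
    by (simp add: power_0_left)
  then show ?case by simp
next
  case (Suc k)
  have "1 / (- real (Suc k)) ^ b = (-1) ^ b * (1 / real (Suc k) ^ b)"
    using power_minus[of "real (Suc k)" b] by (cases "even b") simp_all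
  moreover have "(\<lambda>d. 1 / real_of_int (- int (Suc (Suc k)) + int (Suc d)) ^ b) sums
      (zeta_value b + (-1) ^ b * zeta_part k b + 1 / real_of_int (- int (Suc (Suc k)) + int (Suc 0)) ^ b)"
    using Suc by (subst sums_Suc_iff[symmetric]) simp
  ultimately show ?case by (simp add: zeta_part_Suc algebra_simps)
qed

lemma reducible_quadratic_sum:
  assumes a: "a \<ge> 2" and b: "b \<ge> 2" and odd: "odd (a + b)"
  shows "reducible_to_linear_sums (quadratic_sum 1 b a)"
proof -
  let ?u = "\<lambda>n. harm_int n / real_of_int n ^ a" and ?v = "\<lambda>m. 1 / real_of_int m ^ b"
  let ?F = "\<lambda>(n, d). ?u n * ?v (n + int (Suc d))"
  let ?t = "\<lambda>n. infsum (\<lambda>d. ?v (n + int (Suc d))) UNIV"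
  have u: "?u summable_on UNIV" by (rule has_sum_imp_summable[OF has_sum_harm_int_div_power[OF a]])
  have v: "?v summable_on UNIV" by (rule has_sum_imp_summable[OF has_sum_inverse_power_int[OF b]])
  \<comment> \<open>The pairs \<open>n < m\<close> are parametrized injectively by \<open>n\<close>
    and \<open>d\<close> with \<open>m = n + Suc d\<close>; summability is inherited from the full
    product.\<close>
  have "(\<lambda>(n, m). ?u n * ?v m) summable_on range (\<lambda>(n, d). (n, n + int (Suc d)))"
    by (rule summable_on_subset[OF summable_on_times_real[OF u v]]) simp
  then have "?F summable_on UNIV \<times> UNIV"
    by (subst (asm) summable_on_reindex) (auto simp: inj_on_def o_def case_prod_unfold)
  then obtain S where S: "(?F has_sum S) (UNIV \<times> UNIV)" by (auto simp: summable_on_def)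
  have "reducible_to_linear_sums S"
  proof -
    \<comment> \<open>First evaluation: sum over \<open>n\<close> for fixed \<open>d\<close>. As
      \<open>min a b \<ge> 2\<close>, the outer sum is reducible.\<close>
    have "((\<lambda>d. harm_series a b (Suc d)) has_sum S) UNIV"
    proof (rule has_sum_SigmaD)
      show "((\<lambda>(d, n). ?F (n, d)) has_sum S) (UNIV \<times> UNIV)"
        using S by (subst (asm) has_sum_swap)
      show "((\<lambda>n. (\<lambda>(d, n). ?F (n, d)) (d, n)) has_sum harm_series a b (Suc d)) UNIV" for d
        using harm_series_has_sum[of a b "Suc d"] a by (simp add: harm_term_def[abs_def])
    qed
    moreover have "harmonic_span 2 (\<lambda>n. harm_series a b (Suc n))"
      using harmonic_span_mono[OF harmonic_span_harm_series[of a b], of 2] a b by simp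
    ultimately show ?thesis
      using harmonic_span_sums has_sum_imp_sums sums_unique2 by blast
  qed
  \<comment> \<open>Second evaluation: sum over \<open>d\<close> for fixed \<open>n\<close>, then
    split by the sign of \<open>n\<close>. Each half contributes one negative copy of the quadratic
    sum.\<close>
  moreover have S_eq: "S = zeta_value b * (linear_sum 1 a - zeta_value (a + 1)) + linear_sum b (a + 1)
      + (-1) ^ a * (zeta_value b * linear_sum 1 a) + linear_sum 1 (a + b) - 2 * quadratic_sum 1 b a"
  proof -
    have tail: "((\<lambda>d. ?v (n + int (Suc d))) has_sum ?t n) UNIV" for n
    proof (rule has_sum_infsum)
      have "(\<lambda>m. ?v m) summable_on range (\<lambda>d. n + int (Suc d))"
        using summable_on_subset[OF v] by simp
      then show "(\<lambda>d. ?v (n + int (Suc d))) summable_on UNIV"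
        by (subst (asm) summable_on_reindex) (auto simp: inj_on_def o_def)
    qed
    have "((\<lambda>n. ?u n * ?t n) has_sum S) UNIV"
      by (rule has_sum_SigmaD[OF S]) (simp only: prod.case, intro has_sum_cmult_right tail)
    moreover have "(\<lambda>n. ?u (int (Suc n)) * ?t (int (Suc n))) sums
        (zeta_value b * (linear_sum 1 a - zeta_value (a + 1)) - quadratic_sum 1 b a + linear_sum b (a + 1))"
    proof -
      have t: "?t (int k) = zeta_value b - zeta_part k b" for k
        using sums_unique2[OF has_sum_imp_sums[OF tail] zeta_tail_sums_nonneg[OF b]] .
      have "(H - 1 / x) / x ^ a * (z - Z) = z * (H / x ^ a - 1 / x ^ (a + 1)) - H * Z / x ^ a + Z / x ^ (a + 1)"
        for H x z Z :: real
        by (simp add: algebra_simps diff_divide_distrib)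
      then have "?u (int (Suc n)) * ?t (int (Suc n)) =
          zeta_value b * (zeta_part (Suc n) 1 / real (Suc n) ^ a - 1 / real (Suc n) ^ (a + 1))
          - zeta_part (Suc n) 1 * zeta_part (Suc n) b / real (Suc n) ^ a
          + zeta_part (Suc n) b / real (Suc n) ^ (a + 1)" for n
        unfolding t harm_int_pos of_int_of_nat_eq .
      then show ?thesis
        using a b by (simp only:)
          (intro sums_add sums_diff sums_mult linear_sum_sums zeta_value_sums quadratic_sum_sums, auto)
    qed
    moreover have "(\<lambda>n. ?u (- int (Suc n)) * ?t (- int (Suc n))) sums
        ((-1) ^ a * (zeta_value b * linear_sum 1 a) - (quadratic_sum 1 b a - linear_sum 1 (a + b)))"
    proof -
      have t: "?t (- int (Suc k)) = zeta_value b + (-1) ^ b * zeta_part k b" for k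
        using sums_unique2[OF has_sum_imp_sums[OF tail] zeta_tail_sums_neg[OF b]] .
      have "?u (- int (Suc n)) * ?t (- int (Suc n)) =
          (-1) ^ a * (zeta_value b * (zeta_part (Suc n) 1 / real (Suc n) ^ a))
          - (zeta_part (Suc n) 1 * zeta_part (Suc n) b / real (Suc n) ^ a
            - zeta_part (Suc n) 1 / real (Suc n) ^ (a + b))" for n
      proof -
        have x: "real_of_int (- int (Suc n)) ^ a = (-1) ^ a * real (Suc n) ^ a"
          using power_minus[of "real (Suc n)" a] by simp
        \<comment> \<open>Here \<open>s\<close> and \<open>s'\<close> stand for
          \<open>(-1) ^ a\<close> and \<open>(-1) ^ b\<close>, and the odd weight gives
          \<open>s * s' = -1\<close>. Rewriting \<open>Z\<close> as
          \<open>(Z + 1 / Y) - 1 / Y\<close> completes the partial sum up to \<open>Suc n\<close>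
          and leaves a linear sum.\<close>
        have ring: "H / (s * X) * (z + s' * Z) = s * (z * (H / X)) - (H * (Z + 1 / Y) / X - H / (X * Y))"
          if "s * s = 1" "s * s' = -1" for H X z Y Z s s' :: real
        proof -
          have "inverse s = s" using that(1) by (rule inverse_unique)
          then have "H / (s * X) = s * (H / X)" by (simp add: divide_inverse mult_ac)
          then have "H / (s * X) * (z + s' * Z) = s * (z * (H / X)) + (s * s') * (H / X * Z)"
            by (simp add: algebra_simps add_divide_distrib)
          then show ?thesis unfolding that(2) by (simp add: algebra_simps add_divide_distrib)
        qed
        have "(-1) ^ a * (-1) ^ a = (1::real)" "(-1) ^ a * (-1) ^ b = (-1::real)"
          using odd by (simp_all add: power_add[symmetric])
        then show ?thesis
          unfolding t harm_int_neg x zeta_part_Suc[of n b] power_add[of _ a b] by (rule ring)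
      qed
      then show ?thesis
        using a b by (simp only:)
          (intro sums_add sums_diff sums_mult linear_sum_sums quadratic_sum_sums, auto)
    qed
    ultimately have "S = ?u 0 * ?t 0
        + (zeta_value b * (linear_sum 1 a - zeta_value (a + 1)) - quadratic_sum 1 b a + linear_sum b (a + 1))
        + ((-1) ^ a * (zeta_value b * linear_sum 1 a) - (quadratic_sum 1 b a - linear_sum 1 (a + b)))"
      by (rule has_sum_int_unsplit)
    then show ?thesis by simp
  qed
  ultimately have "reducible_to_linear_sums (1 / 2 *
      (zeta_value b * (linear_sum 1 a - zeta_value (a + 1)) + linear_sum b (a + 1)
      + (-1) ^ a * (zeta_value b * linear_sum 1 a) + linear_sum 1 (a + b) - S))"
    using a b
    by (intro reducible_mult[OF reducible_half] reducible_add reducible_diff reducible_sign_mult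
        reducible_mult[OF reducible_zeta_value] reducible_linear_sum reducible_zeta_value) auto
  then show ?thesis unfolding S_eq by simp
qed

text \<open>In either order the exponents \<open>p + 1\<close> and \<open>p + 2 * m\<close> are at
  least 2, and their sum \<open>2 * p + 2 * m + 1\<close> is odd.\<close>

theorem theorem3p5:
  fixes p m :: nat
  assumes "p \<ge> 1" and "m \<ge> 1"
  shows "reducible_to_linear_sums (quadratic_sum 1 (p + 1) (p + 2 * m)) \<and>
         reducible_to_linear_sums (quadratic_sum 1 (p + 2 * m) (p + 1))"
  using assms by (intro conjI reducible_quadratic_sum) auto

end
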